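(* Let $(\Omega,\mathcal{F},P)$ be a probability space and let $\boldsymbol{X}=(X_1,\dots,X_n)\in Ln_1$. The (constant) vector $\boldsymbol{m}_\ell\in(0,\infty)^n$ that minimizes the logarithmic distance to $\boldsymbol{X}$ is given by $$\boldsymbol{m}_\ell(\boldsymbol{X})=\exp\left(E[\ln\boldsymbol{X}]\right).$$
   Context: All operations on vectors (products, powers, $\ln$, $\exp$) are componentwise, so $\boldsymbol{m}_\ell(\boldsymbol{X})_j=\exp(E[\ln X_j])$ for $j=1,\dots,n$. Random variables that are $P$-a.e. equal are identified. $\mathcal{C}$ denotes the set of $P$-a.e. finite and strictly positive ($(0,\infty)^n$-valued) random variables, and, for $p=1,2$, $Ln_p=\{\boldsymbol{X}\in\mathcal{C} : E[|\ln X_i|^p]<\infty,\ i=1,\dots,n\}$. The logarithmic distance $d_\ell$ is introduced, for strictly positive random variables $\boldsymbol{X}_1,\boldsymbol{X}_2\in Ln_2$, by $$d_\ell(\boldsymbol{X}_1,\boldsymbol{X}_2)^2=E\left[\sum_{i=1}^n\left(\ln X_1(i)-\ln X_2(i)\right)^2\right].$$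
   Formalization: The logarithmic distance is allowed to be infinite; minimality is proved for X in Ln_1, uniqueness of the minimizer only for X in Ln_2, since for X in Ln_1 but not Ln_2 every constant positive vector is at infinite distance and uniqueness fails. *)

theory Defs
  imports "HOL-Probability.Probability"
begin

definition pos_vecs :: "(real ^ 'n) set" where
  "pos_vecs = {m. \<forall>i. 0 < m $ i}"

text \<open>Random variables that are a.e. equal are identified, so they are represented by real-valued
  measurable functions; positivity is required almost everywhere, and
  values on a null set do not affect any of the notions below.\<close>

definition pos_rvs :: "'a measure \<Rightarrow> ('a \<Rightarrow> real ^ 'n) set" where
  "pos_rvs M = {X \<in> borel_measurable M. AE \<omega> in M. X \<omega> \<in> pos_vecs}"

definition Lnp :: "'a measure \<Rightarrow> nat \<Rightarrow> ('a \<Rightarrow> real ^ 'n) set" where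
  "Lnp M p = {X \<in> pos_rvs M. \<forall>i. integrable M (\<lambda>\<omega>. \<bar>ln (X \<omega> $ i)\<bar> ^ p)}"

definition ennreal_sqrt :: "ennreal \<Rightarrow> ennreal" where
  "ennreal_sqrt x = (if x = \<top> then \<top> else ennreal (sqrt (enn2real x)))"

text \<open>The distance takes the value \<open>\<infinity>\<close> when the expectation is infinite, so that it also makes
  sense for arguments outside \<open>Lnp M 2\<close>; the Bochner integral would return the default value 0 there.
  The lemma below confirms that on \<open>Lnp M 2\<close> it is the usual real-valued distance.\<close>

definition log_dist :: "'a measure \<Rightarrow> ('a \<Rightarrow> real ^ 'n) \<Rightarrow> ('a \<Rightarrow> real ^ 'n) \<Rightarrow> ennreal" where
  "log_dist M X Y =
     ennreal_sqrt (\<integral>\<^sup>+\<omega>. ennreal (\<Sum>i\<in>UNIV. (ln (X \<omega> $ i) - ln (Y \<omega> $ i))\<^sup>2) \<partial>M)"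

definition log_mean :: "'a measure \<Rightarrow> ('a \<Rightarrow> real ^ 'n) \<Rightarrow> real ^ 'n" where
  "log_mean M X = (\<chi> j. exp (\<integral>\<omega>. ln (X \<omega> $ j) \<partial>M))"

lemma log_dist_Ln2:
  fixes X Y :: "'a \<Rightarrow> real ^ 'n"
  assumes X: "X \<in> Lnp M 2" and Y: "Y \<in> Lnp M 2"
  shows "log_dist M X Y =
    ennreal (sqrt (\<integral>\<omega>. (\<Sum>i\<in>UNIV. (ln (X \<omega> $ i) - ln (Y \<omega> $ i))\<^sup>2) \<partial>M))"
proof -
  have [measurable]: "X \<in> borel_measurable M" "Y \<in> borel_measurable M"
    using X Y by (auto simp: Lnp_def pos_rvs_def)
  have comp [measurable]: "(\<lambda>\<omega>. X \<omega> $ i) \<in> borel_measurable M"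
    "(\<lambda>\<omega>. Y \<omega> $ i) \<in> borel_measurable M" for i
    by (simp_all add: cart_eq_inner_axis)
  have "integrable M (\<lambda>\<omega>. (ln (X \<omega> $ i) - ln (Y \<omega> $ i))\<^sup>2)" for i
  proof (rule Bochner_Integration.integrable_bound)
    show "integrable M (\<lambda>\<omega>. 2 * \<bar>ln (X \<omega> $ i)\<bar>\<^sup>2 + 2 * \<bar>ln (Y \<omega> $ i)\<bar>\<^sup>2)"
      using X Y by (auto simp: Lnp_def)
    have "(a - b)\<^sup>2 \<le> 2 * a\<^sup>2 + 2 * b\<^sup>2" for a b :: real
      using zero_le_power2[of "a + b"] by (simp add: power2_sum power2_diff)
    then show "AE \<omega> in M. norm ((ln (X \<omega> $ i) - ln (Y \<omega> $ i))\<^sup>2)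
        \<le> norm (2 * \<bar>ln (X \<omega> $ i)\<bar>\<^sup>2 + 2 * \<bar>ln (Y \<omega> $ i)\<bar>\<^sup>2)"
      by simp
  qed measurable
  then have "integrable M (\<lambda>\<omega>. \<Sum>i\<in>UNIV. (ln (X \<omega> $ i) - ln (Y \<omega> $ i))\<^sup>2)"
    by simp
  then show ?thesis
    by (simp add: log_dist_def ennreal_sqrt_def nn_integral_eq_integral sum_nonneg)
qed

end

theory Submission imports Defs begin

text \<open>In logarithmic coordinates \<open>Y = ln X\<close>, \<open>c = ln m\<close> the squared distance from \<open>X\<close> to a constant
  is \<open>E[|Y - c|^2]\<close>, and the claim is that the mean of \<open>Y\<close> is the best constant approximation of \<open>Y\<close>
  in mean square. As \<open>Y - E[Y]\<close> has mean zero, the cross term of the expanded square vanishes, so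

    \<open>E[|Y - c|^2] = E[|Y - E[Y]|^2] + |E[Y] - c|^2\<close>.

  The only dependence on \<open>c\<close> is in the last term, which is zero exactly for \<open>c = E[Y]\<close>, that is for
  \<open>m = exp (E[Y])\<close>.

  The identity holds in \<open>[0, \<infinity>]\<close> for every integrable \<open>Y\<close> (\<open>sq_log_dist_pythagoras\<close>), because
  the difference of the two squared norms is an affine function of \<open>Y\<close>, hence integrable even when
  neither of them is. It gives minimality for all \<open>X\<close> in \<open>Lnp M 1\<close>. Outside \<open>Lnp M 2\<close> all the distances
  are infinite and every positive constant is a minimizer. Uniqueness is obtained by cancelling the first
  term on the right, which therefore has to be finite: this is where \<open>X \<in> Lnp M 2\<close> is used.\<close>

lemma ennreal_sqrt_le_iff: "ennreal_sqrt x \<le> ennreal_sqrt y \<longleftrightarrow> x \<le> y"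
  by (cases x; cases y) (auto simp: ennreal_sqrt_def top_unique)

text \<open>Splitting \<open>v - u\<close> into its positive part \<open>p\<close> and negative part \<open>q\<close> turns the claim into
  \<open>u + p = v + q\<close>. This identity between nonnegative functions can be integrated without
  assuming that \<open>u\<close> or \<open>v\<close> has a finite integral, and the integral of \<open>q\<close>, which is finite, can then
  be cancelled.\<close>

lemma nn_integral_eq_add_integral_diff:
  fixes u v :: "'a \<Rightarrow> real"
  assumes [measurable]: "u \<in> borel_measurable M" "v \<in> borel_measurable M"
    and nonneg: "\<And>x. 0 \<le> u x" "\<And>x. 0 \<le> v x"
    and int: "integrable M (\<lambda>x. v x - u x)"
    and d: "0 \<le> (\<integral>x. v x - u x \<partial>M)"
  shows "(\<integral>\<^sup>+x. v x \<partial>M) = (\<integral>\<^sup>+x. u x \<partial>M) + ennreal (\<integral>x. v x - u x \<partial>M)"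
proof -
  define p where "p = (\<lambda>x. max 0 (v x - u x))"
  define q where "q = (\<lambda>x. max 0 (u x - v x))"
  have "integrable M (\<lambda>x. u x - v x)"
    using Bochner_Integration.integrable_minus[OF int] by simp
  then have intp: "integrable M p" and intq: "integrable M q"
    unfolding p_def q_def using int by (auto intro!: integrable_max)
  have pq: "p x \<ge> 0" "q x \<ge> 0" "p x - q x = v x - u x" "u x + p x = v x + q x" for x
    by (auto simp: p_def q_def max_def)
  have [measurable]: "p \<in> borel_measurable M" "q \<in> borel_measurable M"
    using intp intq by auto
  let ?d = "\<integral>x. v x - u x \<partial>M"
  have "(\<integral>x. p x \<partial>M) = (\<integral>x. q x \<partial>M) + ?d"
    using Bochner_Integration.integral_diff[OF intp intq] by (simp add: pq)
  then have P: "(\<integral>\<^sup>+x. p x \<partial>M) = (\<integral>\<^sup>+x. q x \<partial>M) + ennreal ?d"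
    using d by (simp add: nn_integral_eq_integral intp intq pq ennreal_plus)
  have "(\<integral>\<^sup>+x. u x \<partial>M) + (\<integral>\<^sup>+x. p x \<partial>M) = (\<integral>\<^sup>+x. ennreal (u x + p x) \<partial>M)"
    using nonneg pq(1) by (simp add: ennreal_plus nn_integral_add)
  also have "\<dots> = (\<integral>\<^sup>+x. v x \<partial>M) + (\<integral>\<^sup>+x. q x \<partial>M)"
    using nonneg pq(1,2) by (simp add: pq(4) ennreal_plus nn_integral_add)
  finally have "(\<integral>\<^sup>+x. q x \<partial>M) + (\<integral>\<^sup>+x. v x \<partial>M) =
      (\<integral>\<^sup>+x. q x \<partial>M) + ((\<integral>\<^sup>+x. u x \<partial>M) + ennreal ?d)"
    by (auto simp: P ac_simps)
  moreover have "(\<integral>\<^sup>+x. q x \<partial>M) \<noteq> \<top>"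
    by (simp add: nn_integral_eq_integral intq pq)
  ultimately show ?thesis
    by (simp add: ennreal_add_left_cancel)
qed

lemma log_mean_pos: "log_mean M X \<in> pos_vecs"
  by (simp add: log_mean_def pos_vecs_def)

definition sq_log_dist :: "'a measure \<Rightarrow> ('a \<Rightarrow> real ^ 'n) \<Rightarrow> real ^ 'n \<Rightarrow> ennreal" where
  "sq_log_dist M X m = (\<integral>\<^sup>+\<omega>. ennreal (\<Sum>i\<in>UNIV. (ln (X \<omega> $ i) - ln (m $ i))\<^sup>2) \<partial>M)"

lemma log_dist_const_le_iff:
  "log_dist M X (\<lambda>_. m) \<le> log_dist M X (\<lambda>_. m') \<longleftrightarrow> sq_log_dist M X m \<le> sq_log_dist M X m'"
  by (simp add: log_dist_def sq_log_dist_def ennreal_sqrt_le_iff)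

lemma sq_log_dist_pythagoras:
  fixes X :: "'a \<Rightarrow> real ^ 'n"
  assumes "prob_space M" and X: "X \<in> Lnp M 1"
  shows "sq_log_dist M X m = sq_log_dist M X (log_mean M X) +
    ennreal (\<Sum>i\<in>UNIV. (ln (log_mean M X $ i) - ln (m $ i))\<^sup>2)"
proof -
  interpret prob_space M by fact
  have [measurable]: "X \<in> borel_measurable M"
    using X by (auto simp: Lnp_def pos_rvs_def)
  have [measurable]: "(\<lambda>\<omega>. X \<omega> $ i) \<in> borel_measurable M" for i
    by (simp add: cart_eq_inner_axis)
  have "integrable M (\<lambda>\<omega>. \<bar>ln (X \<omega> $ i)\<bar>)" for i
    using X by (simp add: Lnp_def)
  then have intY: "integrable M (\<lambda>\<omega>. ln (X \<omega> $ i))" for i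
    by (subst (asm) integrable_abs_iff) measurable
  define a where "a i = expectation (\<lambda>\<omega>. ln (X \<omega> $ i))" for i
  define c where "c i = ln (m $ i)" for i
  have ln_mean: "ln (log_mean M X $ i) = a i" for i
    by (simp add: log_mean_def a_def)
  let ?u = "\<lambda>\<omega>. \<Sum>i\<in>UNIV. (ln (X \<omega> $ i) - a i)\<^sup>2"
  let ?v = "\<lambda>\<omega>. \<Sum>i\<in>UNIV. (ln (X \<omega> $ i) - c i)\<^sup>2"
  \<comment> \<open>Expanding around the mean leaves a linear term with expectation zero and a constant.\<close>
  have diff: "?v \<omega> - ?u \<omega> =
      (\<Sum>i\<in>UNIV. 2 * (a i - c i) * (ln (X \<omega> $ i) - a i) + (a i - c i)\<^sup>2)" for \<omega>
    by (simp add: sum_subtractf[symmetric] power2_eq_square algebra_simps)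
  have "integrable M (\<lambda>\<omega>. ?v \<omega> - ?u \<omega>)"
    unfolding diff using intY by auto
  moreover have "expectation (\<lambda>\<omega>. ?v \<omega> - ?u \<omega>) = (\<Sum>i\<in>UNIV. (a i - c i)\<^sup>2)"
    unfolding diff using intY by (simp add: prob_space a_def)
  ultimately have "(\<integral>\<^sup>+\<omega>. ?v \<omega> \<partial>M) = (\<integral>\<^sup>+\<omega>. ?u \<omega> \<partial>M) + ennreal (\<Sum>i\<in>UNIV. (a i - c i)\<^sup>2)"
    using nn_integral_eq_add_integral_diff[of ?u M ?v] by (simp add: sum_nonneg)
  then show ?thesis
    by (simp add: sq_log_dist_def ln_mean c_def)
qed

text \<open>The distance to the vector \<open>(1, \<dots>, 1)\<close>, whose logarithm is zero, is finite for \<open>X\<close> in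
  \<open>Lnp M 2\<close>, and it bounds the distance to the mean.\<close>

lemma sq_log_dist_log_mean_finite:
  fixes X :: "'a \<Rightarrow> real ^ 'n"
  assumes "prob_space M" and "X \<in> Lnp M 1" and X: "X \<in> Lnp M 2"
  shows "sq_log_dist M X (log_mean M X) \<noteq> \<top>"
proof -
  have "integrable M (\<lambda>\<omega>. \<Sum>i\<in>UNIV. (ln (X \<omega> $ i))\<^sup>2)"
    using X by (simp add: Lnp_def)
  then have "sq_log_dist M X (\<chi> i. 1) \<noteq> \<top>"
    by (simp add: sq_log_dist_def nn_integral_eq_integral sum_nonneg)
  then show ?thesis
    using sq_log_dist_pythagoras[OF assms(1,2), of "\<chi> i. 1"] by auto
qed

theorem proposition2p1:
  fixes M :: "'a measure" and X :: "'a \<Rightarrow> real ^ 'n"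
  assumes "prob_space M" and "X \<in> Lnp M 1"
  shows "is_arg_min (\<lambda>m. log_dist M X (\<lambda>_. m)) (\<lambda>m. m \<in> pos_vecs) (log_mean M X) \<and>
    (X \<in> Lnp M 2 \<longrightarrow>
      (\<forall>m. is_arg_min (\<lambda>m. log_dist M X (\<lambda>_. m)) (\<lambda>m. m \<in> pos_vecs) m \<longrightarrow> m = log_mean M X))"
proof (intro conjI impI allI)
  note pythagoras = sq_log_dist_pythagoras[OF assms]
  have "log_dist M X (\<lambda>_. log_mean M X) \<le> log_dist M X (\<lambda>_. m)" for m
    unfolding log_dist_const_le_iff using pythagoras[of m] by simp
  then show "is_arg_min (\<lambda>m. log_dist M X (\<lambda>_. m)) (\<lambda>m. m \<in> pos_vecs) (log_mean M X)"
    by (simp add: is_arg_min_def log_mean_pos not_less)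
next
  fix m
  assume "X \<in> Lnp M 2"
    and min: "is_arg_min (\<lambda>m. log_dist M X (\<lambda>_. m)) (\<lambda>m. m \<in> pos_vecs) m"
  then have finite: "sq_log_dist M X (log_mean M X) \<noteq> \<top>"
    using sq_log_dist_log_mean_finite assms by blast
  let ?d = "\<Sum>i\<in>UNIV. (ln (log_mean M X $ i) - ln (m $ i))\<^sup>2"
  have "sq_log_dist M X m \<le> sq_log_dist M X (log_mean M X)"
    using min by (auto simp: is_arg_min_def log_mean_pos not_less log_dist_const_le_iff[symmetric])
  then have "sq_log_dist M X (log_mean M X) + ennreal ?d \<le> sq_log_dist M X (log_mean M X) + 0"
    using sq_log_dist_pythagoras[OF assms, of m] by simp
  then have "ennreal ?d \<le> 0"
    using finite by (simp only: ennreal_add_left_cancel_le) simp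
  then have "?d = 0"
    by (simp add: ennreal_eq_0_iff order_antisym sum_nonneg)
  then have "ln (log_mean M X $ i) = ln (m $ i)" for i
    by (simp add: sum_nonneg_eq_0_iff)
  moreover have "0 < m $ i" "0 < log_mean M X $ i" for i
    using min log_mean_pos[of M X] by (auto simp: is_arg_min_def pos_vecs_def)
  ultimately show "m = log_mean M X"
    by (simp add: vec_eq_iff)
qed

end
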